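(* Let $p$ be a prime number, let $k\ge 2$ and $n\ge 2$ be integers, and let $\epsilon_1,\epsilon_2\in\{-1,+1\}$. Then the polynomial $f(x)=x^n+\epsilon_1 x+\epsilon_2 p^k$ is irreducible over $\mathbb{Q}$. *)

theory Defs
  imports "HOL-Computational_Algebra.Computational_Algebra"
begin

end

theory Submission
  imports Defs
begin

text \<open>
  By Gauss's lemma it suffices to exclude a factorisation of \<open>f\<close> into nonconstant integer
  polynomials \<open>g * h\<close>. Since \<open>\<plusminus>1 = g\<^sub>0 h\<^sub>1 + g\<^sub>1 h\<^sub>0\<close>, the prime \<open>p\<close> does not divide both constant terms,
  and since their product is \<open>\<plusminus>p\<^sup>k\<close>, one of them is \<open>\<plusminus>1\<close>. As \<open>p\<^sup>k > 2\<close>, all complex roots of \<open>f\<close> lie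
  outside the closed unit disc, so that factor, whose constant term is up to sign its leading
  coefficient times the product of its roots, has constant term of modulus larger than \<open>1\<close>.
\<close>

lemma map_poly_of_int_add:
  "map_poly (of_int :: int \<Rightarrow> 'a :: ring_char_0) (p + q) = map_poly of_int p + map_poly of_int q"
  by (intro poly_eqI) (simp add: coeff_map_poly)

lemma map_poly_of_int_mult:
  "map_poly (of_int :: int \<Rightarrow> 'a :: {comm_ring_1,ring_char_0}) (p * q) =
     map_poly of_int p * map_poly of_int q"
  by (intro poly_eqI) (simp add: coeff_map_poly coeff_mult)

lemma map_poly_of_int_smult:
  "map_poly (of_int :: int \<Rightarrow> 'a :: {comm_ring_1,ring_char_0}) (smult c p) =
     smult (of_int c) (map_poly of_int p)"
  by (intro poly_eqI) (simp add: coeff_map_poly)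

lemma map_poly_of_int_eq_iff:
  "map_poly (of_int :: int \<Rightarrow> 'a :: ring_char_0) p = map_poly of_int q \<longleftrightarrow> p = q"
  by (simp add: poly_eq_iff coeff_map_poly)

lemma degree_map_poly_of_int [simp]:
  "degree (map_poly (of_int :: int \<Rightarrow> 'a :: ring_char_0) p) = degree p"
  by (intro degree_map_poly) auto

text \<open>By induction on the coefficient list: the multiplier found for the tail is multiplied by
  the denominator of the new coefficient.\<close>

lemma rat_poly_clear_denominators:
  fixes g :: "rat poly"
  obtains c :: int and G :: "int poly" where "c \<noteq> 0" "smult (of_int c) g = map_poly of_int G"
proof -
  have "\<exists>(c::int) G. c \<noteq> 0 \<and> smult (of_int c) g = map_poly of_int G"
  proof (induction g)
    case 0
    show ?case by (intro exI[of _ 1] exI[of _ 0]) simp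
  next
    case (pCons a g)
    then obtain c :: int and G where cG: "c \<noteq> 0" "smult (of_int c) g = map_poly of_int G"
      by blast
    obtain u v where uv: "quotient_of a = (u, v)"
      by fastforce
    have v: "v > 0" and a: "a = of_int u / of_int v"
      using uv quotient_of_denom_pos quotient_of_div by blast+
    have "smult (of_int (v * c)) (pCons a g) = pCons (of_int (c * u)) (smult (of_int v) (smult (of_int c) g))"
      using v by (simp add: a)
    also have "\<dots> = map_poly of_int (pCons (c * u) (smult v G))"
      by (simp add: cG map_poly_of_int_smult map_poly_pCons)
    finally show ?case
      using v cG(1) by (intro exI[of _ "v * c"] exI[of _ "pCons (c * u) (smult v G)"]) simp
  qed
  thus ?thesis using that by blast
qed

text \<open>Gauss's lemma. Clearing denominators gives \<open>smult (a * b) f = G * H\<close>; as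
  contents multiply and \<open>f\<close> has content 1, cancelling \<open>\<bar>a * b\<bar>\<close>
  leaves \<open>f\<close> as the product of the two primitive parts, up to sign.\<close>

lemma primitive_int_poly_rat_factorization:
  fixes f :: "int poly" and g h :: "rat poly"
  assumes f: "content f = 1" and gh: "map_poly of_int f = g * h"
  obtains G H :: "int poly" where "f = G * H" "degree G = degree g" "degree H = degree h"
proof -
  obtain a G where a: "a \<noteq> 0" and G: "smult (of_int a) g = map_poly of_int G"
    by (rule rat_poly_clear_denominators)
  obtain b H where b: "b \<noteq> 0" and H: "smult (of_int b) h = map_poly of_int H"
    by (rule rat_poly_clear_denominators)
  have "map_poly rat_of_int (smult (a * b) f) = map_poly of_int (G * H)"
    by (simp add: map_poly_of_int_smult map_poly_of_int_mult gh mult.commute flip: G H)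
  hence eq: "smult (a * b) f = G * H"
    by (simp only: map_poly_of_int_eq_iff)
  from arg_cong[OF this, of content] have c: "\<bar>a * b\<bar> = content G * content H"
    by (simp add: content_mult f abs_mult)
  \<comment> \<open>Contents are nonnegative and so determine \<open>a * b\<close> only up to sign;
    the sign is moved into the first factor.\<close>
  let ?s = "sgn (a * b)"
  have s: "a * b * ?s = \<bar>a * b\<bar>"
    by (simp add: sgn_if)
  have "G * H = smult (content G) (primitive_part G) * smult (content H) (primitive_part H)"
    by simp
  also have "\<dots> = smult (content G * content H) (primitive_part G * primitive_part H)"
    by (simp only: mult_smult_left mult_smult_right smult_smult mult.commute)
  finally have "smult ?s (smult (a * b) f) = smult ?s (smult \<bar>a * b\<bar> (primitive_part G * primitive_part H))"
    by (simp only: eq c)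
  hence "smult \<bar>a * b\<bar> f = smult \<bar>a * b\<bar> (smult ?s (primitive_part G * primitive_part H))"
    by (simp only: smult_smult s mult.commute)
  hence "f = smult ?s (primitive_part G) * primitive_part H"
    using a b by (simp add: poly_eq_iff)
  moreover have "degree (smult ?s (primitive_part G)) = degree g"
    using a b arg_cong[OF G, of degree] by (simp add: sgn_if)
  moreover have "degree (primitive_part H) = degree h"
    using b arg_cong[OF H, of degree] by simp
  ultimately show ?thesis using that by blast
qed

text \<open>Splitting \<open>q\<close> into linear factors shows that the norm of its constant term
  is that of its leading coefficient times the norms of all roots, a nonempty product of numbers
  above 1.\<close>

lemma norm_lead_coeff_less_if_roots_outside_disc:
  fixes q :: "complex poly"
  assumes deg: "degree q > 0" and roots: "\<And>z. poly q z = 0 \<Longrightarrow> norm z > 1"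
  shows "norm (lead_coeff q) < norm (coeff q 0)"
proof -
  have q: "q \<noteq> 0" using deg by auto
  obtain A where A: "size A = degree q" "q = smult (lead_coeff q) (\<Prod>x\<in>#A. [:-x, 1:])"
    using alg_closed_imp_factorization[OF q] by blast
  have poly_q: "poly q z = lead_coeff q * (\<Prod>x\<in>#A. z - x)" for z
    by (subst A(2)) (simp add: poly_prod_mset image_mset.compositionality o_def)
  have "norm x > 1" if "x \<in># A" for x
    using that by (intro roots) (auto simp: poly_q prod_mset_zero_iff)
  \<comment> \<open>Stated for submultisets of \<open>A\<close>, so that during the induction every
    element is still known to be a root. The empty product is 1, so singletons serve as the base
    case.\<close>
  hence gt: "(\<Prod>x\<in>#B. norm x) > 1" if "B \<subseteq># A" "B \<noteq> {#}" for B
    using that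
  proof (induction B)
    case (add x B)
    show ?case
    proof (cases "B = {#}")
      case False
      with add show ?thesis
        by (auto simp: insert_subset_eq_iff intro!: less_1_mult dest: subset_mset.trans[OF _ diff_subset_eq_self])
    qed (use add in auto)
  qed auto
  have "norm (coeff q 0) = norm (lead_coeff q) * (\<Prod>x\<in>#A. norm x)"
  proof -
    have "norm (\<Prod>x\<in>#B. - x) = (\<Prod>x\<in>#B. norm x)" for B :: "complex multiset"
      by (induction B) (auto simp: norm_mult)
    thus ?thesis by (simp add: poly_q norm_mult flip: poly_0_coeff_0)
  qed
  moreover have "A \<noteq> {#}" using A(1) deg by auto
  ultimately show ?thesis using gt[of A] q by simp
qed

text \<open>Roots of \<open>g\<close> are roots of \<open>g * h\<close>, hence outside the disc, and
  a nonzero integer leading coefficient has modulus at least 1.\<close>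

lemma int_poly_factor_const_coeff_gt_1:
  fixes g h :: "int poly"
  assumes "degree g > 0"
    and "\<And>z :: complex. poly (map_poly of_int (g * h)) z = 0 \<Longrightarrow> norm z > 1"
  shows "\<bar>coeff g 0\<bar> > 1"
proof -
  let ?g = "map_poly of_int g :: complex poly"
  have "norm (lead_coeff ?g) < norm (coeff ?g 0)"
    using assms by (intro norm_lead_coeff_less_if_roots_outside_disc) (auto simp: map_poly_of_int_mult)
  hence "\<bar>lead_coeff g\<bar> < \<bar>coeff g 0\<bar>"
    by (simp add: coeff_map_poly)
  moreover have "lead_coeff g \<noteq> 0" using assms(1) by auto
  ultimately show ?thesis by linarith
qed

text \<open>Since \<open>e\<close> is a unit, \<open>a\<close> divides \<open>p ^ k\<close>; being
  also coprime to it, \<open>a\<close> is a unit.\<close>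

lemma prime_not_dvd_imp_abs_eq_1:
  fixes a b p e :: int
  assumes "prime p" "a * b = e * p ^ k" "\<bar>e\<bar> = 1" "\<not> p dvd a"
  shows "\<bar>a\<bar> = 1"
proof -
  have "is_unit e" using assms(3) by simp
  hence "a dvd p ^ k"
    using assms(2) by (metis dvd_mult_unit_iff' dvd_triv_left)
  moreover have "coprime a (p ^ k)"
    using prime_imp_coprime[OF assms(1,4)] by (simp add: coprime_commute)
  ultimately show ?thesis
    using coprime_absorb_left[of a "p ^ k"] by simp
qed

theorem theorem2:
  fixes p k n :: nat and \<epsilon>\<^sub>1 \<epsilon>\<^sub>2 :: rat
  assumes "prime p" and "k \<ge> 2" and "n \<ge> 2"
    and "\<epsilon>\<^sub>1 \<in> {-1, 1}" and "\<epsilon>\<^sub>2 \<in> {-1, 1}"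
  shows "irreducible (monom 1 n + monom \<epsilon>\<^sub>1 1 + [:\<epsilon>\<^sub>2 * of_nat p ^ k:])"
proof -
  obtain d e :: int where d: "\<epsilon>\<^sub>1 = of_int d" "\<bar>d\<bar> = 1" and e: "\<epsilon>\<^sub>2 = of_int e" "\<bar>e\<bar> = 1"
    using assms(4,5) by (metis abs_1 abs_minus_cancel insertE of_int_1 of_int_minus singletonD)
  define P where "P = int p"
  have P: "prime P" using assms(1) by (simp add: P_def)
  define f where "f = monom 1 n + monom d 1 + [:e * P ^ k:]"
  have f_rat: "map_poly of_int f = monom 1 n + monom \<epsilon>\<^sub>1 1 + [:\<epsilon>\<^sub>2 * of_nat p ^ k:]"
    by (simp add: f_def P_def d e map_poly_of_int_add map_poly_monom map_poly_pCons)
  have coeff_f: "coeff f n = 1" "coeff f 1 = d" "coeff f 0 = e * P ^ k" "degree f = n"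
  proof -
    \<comment> \<open>As \<open>n \<ge> 2\<close>, the three terms have distinct degrees.\<close>
    show "coeff f n = 1" "coeff f 1 = d" "coeff f 0 = e * P ^ k"
      using assms(3) by (auto simp: f_def coeff_pCons split: nat.splits)
    thus "degree f = n"
      using assms(3) by (intro antisym degree_le le_degree) (auto simp: f_def coeff_pCons split: nat.splits)
  qed
  \<comment> \<open>The content divides the leading coefficient 1.\<close>
  have content_f: "content f = 1"
    using content_dvd_coeff[of f n] normalize_content[of f] coeff_f(1)
    by (metis is_unit_normalize)
  have roots: "norm z > 1" if "poly (map_poly of_int f) z = 0" for z :: complex
  proof (rule ccontr)
    assume "\<not> norm z > 1"
    hence z: "norm z \<le> 1" by simp
    have "map_poly of_int f = monom 1 n + monom (of_int d) 1 + [:of_int e * of_int P ^ k :: complex:]"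
      by (simp add: f_def map_poly_of_int_add map_poly_monom map_poly_pCons)
    with that have "z ^ n + of_int d * z = - (of_int e * of_int P ^ k)"
      by (simp add: poly_monom eq_neg_iff_add_eq_0)
    hence "norm (z ^ n + of_int d * z) = norm (of_int (e * P ^ k) :: complex)"
      by simp
    also have "\<dots> = real p ^ k"
      using e(2) by (simp add: norm_mult norm_power P_def flip: of_int_abs)
    finally have "real p ^ k \<le> norm (z ^ n) + norm (of_int d * z)"
      using norm_triangle_ineq[of "z ^ n" "of_int d * z"] by simp
    also have "\<dots> = norm z ^ n + norm z"
      using d(2) by (simp add: norm_mult norm_power flip: of_int_abs)
    also have "\<dots> \<le> 2"
      using z power_le_one[of "norm z" n] by simp
    finally have "real p ^ k \<le> 2" .
    \<comment> \<open>The contradiction comes from \<open>p ^ k\<close> being at least 4, by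
      \<open>p \<ge> 2\<close> and \<open>k \<ge> 2\<close>.\<close>
    moreover have "real 2 ^ 2 \<le> real p ^ 2"
      using prime_ge_2_nat[OF assms(1)] by (intro power_mono) auto
    moreover have "real p ^ 2 \<le> real p ^ k"
      using prime_ge_2_nat[OF assms(1)] assms(2) by (intro power_increasing) auto
    ultimately show False by simp
  qed
  have const: "degree G = 0 \<or> degree H = 0" if GH: "f = G * H" for G H
  proof (rule ccontr)
    assume "\<not> ?thesis"
    hence gt: "\<bar>coeff G 0\<bar> > 1" "\<bar>coeff H 0\<bar> > 1"
      using roots int_poly_factor_const_coeff_gt_1[of G H] int_poly_factor_const_coeff_gt_1[of H G]
      by (auto simp: GH mult.commute)
    have c0: "coeff G 0 * coeff H 0 = e * P ^ k"
      using coeff_f(3) by (simp add: GH coeff_mult)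
    have "coeff G 0 * coeff H 1 + coeff G 1 * coeff H 0 = d"
      using coeff_f(2) by (simp add: GH coeff_mult)
    \<comment> \<open>If \<open>P\<close> divided both constant terms, it would divide the linear
      coefficient \<open>d\<close>, which is a unit.\<close>
    moreover have "\<not> P dvd d"
      using d(2) P by (metis dvd_abs_iff not_prime_unit)
    ultimately have "\<not> P dvd coeff G 0 \<or> \<not> P dvd coeff H 0"
      by (metis dvd_add dvd_mult dvd_mult2)
    thus False
      using gt prime_not_dvd_imp_abs_eq_1[OF P c0 e(2)]
        prime_not_dvd_imp_abs_eq_1[OF P _ e(2), of "coeff H 0" "coeff G 0" k] c0
      by (auto simp: mult.commute)
  qed
  let ?f = "map_poly rat_of_int f"
  have "degree ?f > 0" using coeff_f(4) assms(3) by simp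
  hence "?f \<noteq> 0" by force
  \<comment> \<open>Over the field of rationals the units are exactly the nonzero constants, so
    irreducibility becomes a statement about degrees.\<close>
  with \<open>degree ?f > 0\<close> have "\<not> is_unit ?f"
    by (simp add: is_unit_iff_degree)
  moreover note \<open>?f \<noteq> 0\<close>
  moreover have "is_unit g \<or> is_unit h" if gh: "?f = g * h" for g h
  proof -
    obtain G H where "f = G * H" "degree G = degree g" "degree H = degree h"
      by (rule primitive_int_poly_rat_factorization[OF content_f gh])
    with const[of G H] have "degree g = 0 \<or> degree h = 0" by simp
    moreover have "g \<noteq> 0" "h \<noteq> 0" using \<open>?f \<noteq> 0\<close> gh by auto
    ultimately show ?thesis by (auto simp: is_unit_iff_degree)
  qed
  ultimately show ?thesis
    unfolding f_rat[symmetric] by (intro irreducibleI)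
qed

end
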